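(* Let $V^{ATS-Relax}$ and $t^{ATS-Relax}$ denote the objective value and the revision vector of the solution of the adaptive two-stage capacity expansion problem found by Algorithm ATS-Relax, and let $V^{ATS}$ denote the optimal value of the adaptive two-stage capacity expansion problem (with revision times as decision variables). Then $$V^{ATS-Relax}-V^{ATS}\ \le\ \sum_{i=1}^{I}\Big(\max_{n\in\hat{\mathcal T}_i(t_i^{ATS-Relax})}\{\lceil\hat\delta_{in}\rceil-\hat\delta_{in}\}\,a_{i1}\Big),$$ where $\delta_{in}=[A_ny_n^{LP}]_i$ and $y^{LP}$ are the capacity allocation decisions found in Step 1 of Algorithm ATS-Relax.
   Context: $\mathcal T$ is a scenario tree with $T$ stages: a rooted tree (root denoted 1) whose nodes $n$ have period $t_n\in\{1,\dots,T\}$. $S_t$ is the set of nodes of period $t$; $P(n)$ is the set of nodes on the path from the root to $n$ (inclusive); $\mathcal T(n)$ is the subtree rooted at $n$. $p_n$ is the probability of (reaching) node $n$, with $\sum_{n\in S_t}p_n=1$ for each $t$. Adaptive two-stage capacity expansion problem, with resources $\mathcal I$ ($I=|\mathcal I|$), tasks $\mathcal J$, items $\mathcal K$: minimize $\sum_{n\in\mathcal T}p_n(a_n^\top x_n+b_n^\top y_n)$ over $(x,y,t^* )$ subject to $A_ny_n\le\sum_{m\in P(n)}x_m$, $B_ny_n\ge d_n$, $x_n\in\mathbb Z_+^{|\mathcal I|}$, $y_n\in\mathbb R_+^{|\mathcal J|}$ for all $n\in\mathcal T$, and, for each $i$, $t_i^*\in\{1,\dots,T\}$, $x_{im}=x_{in}$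 for all $m,n\in S_t$, $t<t_i^*$, and $x_{im}=x_{in}$ for all $m,n\in S_t\cap\mathcal T(j)$, $j\in S_{t_i^*}$, $t\ge t_i^*$. Here $a_n\in\mathbb R_+^{|\mathcal I|}$, $b_n\in\mathbb R_+^{|\mathcal J|}$, $d_n\in\mathbb R_+^{|\mathcal K|}$. Algorithm ATS-Relax: Step 1: solve the relaxation of the adaptive two-stage problem in which the $x_n$ are continuous ($x_n\in\mathbb R_+^{|\mathcal I|}$) while the revision times remain integer decisions $t_i^*\in\{1,\dots,T\}$ (encoded by binary variables $r_{it}$ with $\sum_t r_{it}=1$); this yields revision times and allocation decisions $y^{LP}$. Step 2: let $t^{ATS-Relax}$ be the revision times found in Step 1. Step 3: solve the adaptive two-stage problem (with integer $x$) over $\{x_n,y_n\}_{n\in\mathcal T}$ with the revision times fixed to $t^{ATS-Relax}$. Condensed tree: $\hat{\mathcal T}_i(t_i)$ is obtained from $\mathcal T$ by merging nodes forced to have equal $x_i$-decisions by the adaptive constraints with revision time $t_i$: its nodes correspond to the sets $S_t$ for $t<t_i$, and $S_t\cap\mathcal T(j)$ for $j\in S_{t_i}$, $t\ge t_i$. If $\hat C_n\subset\mathcal T$ is the set merged into node $n\in\hat{\mathcal T}_i(t_i)$, then $\hat\delta_{in}=\max_{m\in\hat C_n}\delta_{im}$. $[\cdot]_i$ is the $i$-th component of a vector. *)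

theory Defs
  imports "HOL-Analysis.Analysis"
begin

record 'n scenario_tree =
  nodes :: "'n set"
  edges :: "('n \<times> 'n) set"  \<comment> \<open>pairs (parent, child)\<close>
  root_node :: 'n
  horizon :: nat  \<comment> \<open>the number of stages $T$\<close>
  period :: "'n \<Rightarrow> nat"
  prob :: "'n \<Rightarrow> real"

definition stage :: "('n, 'z) scenario_tree_scheme \<Rightarrow> nat \<Rightarrow> 'n set" where
  "stage S t = {n \<in> nodes S. period S n = t}"

definition path_to :: "('n, 'z) scenario_tree_scheme \<Rightarrow> 'n \<Rightarrow> 'n set" where
  "path_to S n = {m \<in> nodes S. (m, n) \<in> (edges S)\<^sup>*}"

definition subtree :: "('n, 'z) scenario_tree_scheme \<Rightarrow> 'n \<Rightarrow> 'n set" where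
  "subtree S n = {m \<in> nodes S. (n, m) \<in> (edges S)\<^sup>*}"

definition rooted_tree :: "'n set \<Rightarrow> ('n \<times> 'n) set \<Rightarrow> 'n \<Rightarrow> bool" where
  "rooted_tree N E r \<longleftrightarrow>
     finite N \<and> r \<in> N \<and> E \<subseteq> N \<times> N \<and>
     (\<forall>m. (m, r) \<notin> E) \<and>
     (\<forall>n\<in>N - {r}. \<exists>!m. (m, n) \<in> E) \<and>
     (\<forall>n\<in>N. (r, n) \<in> E\<^sup>*)"

text \<open>
  Only the stagewise normalisation of the probabilities is required; that the probability of
  a node is the sum of those of its children, and that every leaf has period $T$, are not
  assumed.
\<close>

definition scenario_tree :: "('n, 'z) scenario_tree_scheme \<Rightarrow> bool" where
  "scenario_tree S \<longleftrightarrow>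
     rooted_tree (nodes S) (edges S) (root_node S) \<and>
     period S (root_node S) = 1 \<and>
     (\<forall>(m, n)\<in>edges S. period S n = Suc (period S m)) \<and>
     (\<forall>n\<in>nodes S. period S n \<in> {1..horizon S}) \<and>
     (\<forall>n\<in>nodes S. 0 \<le> prob S n) \<and>
     (\<forall>t\<in>{1..horizon S}. (\<Sum>n\<in>stage S t. prob S n) = 1)"

text \<open>
  Resources, tasks and items are the elements of the finite types \<open>'i\<close>, \<open>'j\<close> and \<open>'k\<close>;
  inequalities between vectors are componentwise.
\<close>

record ('n, 'i, 'j, 'k) capacity_problem = "'n scenario_tree" +
  expansion_cost :: "'n \<Rightarrow> real ^ 'i::finite"  \<comment> \<open>$a_n$\<close>
  allocation_cost :: "'n \<Rightarrow> real ^ 'j::finite"  \<comment> \<open>$b_n$\<close>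
  usage :: "'n \<Rightarrow> real ^ 'j ^ 'i"  \<comment> \<open>$A_n$\<close>
  service :: "'n \<Rightarrow> real ^ 'j ^ 'k::finite"  \<comment> \<open>$B_n$\<close>
  demand :: "'n \<Rightarrow> real ^ 'k"  \<comment> \<open>$d_n$\<close>

definition capacity_expansion ::
    "('n, 'i::finite, 'j::finite, 'k::finite) capacity_problem \<Rightarrow> bool" where
  "capacity_expansion P \<longleftrightarrow>
     scenario_tree P \<and>
     (\<forall>n\<in>nodes P. 0 \<le> expansion_cost P n \<and> 0 \<le> allocation_cost P n \<and> 0 \<le> demand P n)"

definition objective ::
    "('n, 'i::finite, 'j::finite, 'k::finite) capacity_problem \<Rightarrow>
     ('n \<Rightarrow> real ^ 'i) \<Rightarrow> ('n \<Rightarrow> real ^ 'j) \<Rightarrow> real" where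
  "objective P x y =
     (\<Sum>n\<in>nodes P. prob P n * (expansion_cost P n \<bullet> x n + allocation_cost P n \<bullet> y n))"

definition adaptive ::
    "('n, 'z) scenario_tree_scheme \<Rightarrow> ('n \<Rightarrow> real ^ 'i::finite) \<Rightarrow> ('i \<Rightarrow> nat) \<Rightarrow> bool" where
  "adaptive S x t \<longleftrightarrow>
     (\<forall>i. t i \<in> {1..horizon S} \<and>
       (\<forall>s<t i. \<forall>m\<in>stage S s. \<forall>n\<in>stage S s. x m $ i = x n $ i) \<and>
       (\<forall>j\<in>stage S (t i). \<forall>s\<ge>t i.
          \<forall>m\<in>stage S s \<inter> subtree S j. \<forall>n\<in>stage S s \<inter> subtree S j. x m $ i = x n $ i))"

definition relaxed_feasible ::
    "('n, 'i::finite, 'j::finite, 'k::finite) capacity_problem \<Rightarrow>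
     ('n \<Rightarrow> real ^ 'i) \<Rightarrow> ('n \<Rightarrow> real ^ 'j) \<Rightarrow> ('i \<Rightarrow> nat) \<Rightarrow> bool" where
  "relaxed_feasible P x y t \<longleftrightarrow>
     (\<forall>n\<in>nodes P.
        usage P n *v y n \<le> (\<Sum>m\<in>path_to P n. x m) \<and>
        demand P n \<le> service P n *v y n \<and>
        0 \<le> x n \<and> 0 \<le> y n) \<and>
     adaptive P x t"

definition ats_feasible ::
    "('n, 'i::finite, 'j::finite, 'k::finite) capacity_problem \<Rightarrow>
     ('n \<Rightarrow> real ^ 'i) \<Rightarrow> ('n \<Rightarrow> real ^ 'j) \<Rightarrow> ('i \<Rightarrow> nat) \<Rightarrow> bool" where
  "ats_feasible P x y t \<longleftrightarrow>
     relaxed_feasible P x y t \<and> (\<forall>n\<in>nodes P. \<forall>i. x n $ i \<in> \<int>)"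

text \<open>
  The costs are nonnegative, so the set below is bounded from below. It is nonempty as soon as
  the relaxation is feasible: replace \<open>x\<close> by a large integral vector at the root and 0 elsewhere.
\<close>

definition ats_value ::
    "('n, 'i::finite, 'j::finite, 'k::finite) capacity_problem \<Rightarrow> real" where
  "ats_value P = Inf {objective P x y | x y t. ats_feasible P x y t}"

definition ats_relax_step1 ::
    "('n, 'i::finite, 'j::finite, 'k::finite) capacity_problem \<Rightarrow>
     ('n \<Rightarrow> real ^ 'i) \<Rightarrow> ('n \<Rightarrow> real ^ 'j) \<Rightarrow> ('i \<Rightarrow> nat) \<Rightarrow> bool" where
  "ats_relax_step1 P x y t \<longleftrightarrow>
     is_arg_min (\<lambda>(x, y, t). objective P x y) (\<lambda>(x, y, t). relaxed_feasible P x y t) (x, y, t)"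

definition ats_relax_step3 ::
    "('n, 'i::finite, 'j::finite, 'k::finite) capacity_problem \<Rightarrow> ('i \<Rightarrow> nat) \<Rightarrow>
     ('n \<Rightarrow> real ^ 'i) \<Rightarrow> ('n \<Rightarrow> real ^ 'j) \<Rightarrow> bool" where
  "ats_relax_step3 P t x y \<longleftrightarrow>
     is_arg_min (\<lambda>(x, y). objective P x y) (\<lambda>(x, y). ats_feasible P x y t) (x, y)"

text \<open>
  A node of the condensed tree is represented by the set of scenario-tree nodes merged into it.
  Empty intersections, possible if some leaf has period less than $T$, are not nodes.
\<close>

definition condensed_nodes :: "('n, 'z) scenario_tree_scheme \<Rightarrow> nat \<Rightarrow> 'n set set" where
  "condensed_nodes S r =
     ({stage S t | t. 1 \<le> t \<and> t < r} \<union>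
      {stage S t \<inter> subtree S j | t j. j \<in> stage S r \<and> r \<le> t \<and> t \<le> horizon S}) - {{}}"

definition required_capacity ::
    "('n, 'i::finite, 'j::finite, 'k::finite) capacity_problem \<Rightarrow>
     ('n \<Rightarrow> real ^ 'j) \<Rightarrow> 'i \<Rightarrow> 'n \<Rightarrow> real" where  \<comment> \<open>$\delta_{in}$\<close>
  "required_capacity P y i n = (usage P n *v y n) $ i"

definition condensed_capacity ::
    "('n, 'i::finite, 'j::finite, 'k::finite) capacity_problem \<Rightarrow>
     ('n \<Rightarrow> real ^ 'j) \<Rightarrow> 'i \<Rightarrow> 'n set \<Rightarrow> real" where  \<comment> \<open>$\hat\delta_{in}$\<close>
  "condensed_capacity P y i C = Max (required_capacity P y i ` C)"

end

theory Submission
  imports Defs "HOL-Probability.Probability_Measure"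
begin

text \<open>
  The optimal value of the relaxation bounds the optimal value of the adaptive two-stage
  problem from below, so it suffices to turn the solution of Step 1 into an integral one with
  the same revision times and the same allocation, paying at most the claimed bound on top;
  Step 3 can only do better.

  Work with the cumulative capacities \<open>X\<^sub>i\<^sub>n\<close>, the sums of the expansions of resource \<open>i\<close> along the
  path to \<open>n\<close>. Add to each of them the largest rounding gap \<open>\<Delta>\<^sub>i\<close>, the maximum of
  \<open>\<lceil>\<delta>\<rceil> - \<delta>\<close> over the condensed tree. This amounts to buying \<open>\<Delta>\<^sub>i\<close> more at the root, whose
  probability is 1, and so costs exactly \<open>\<Delta>\<^sub>i a\<^sub>i\<^sub>1\<close>. The lifted capacity is at least
  \<open>\<lceil>\<delta>\<rceil>\<close> on every condensed node, because \<open>X\<^sub>i\<^sub>n\<close> is constant there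
  (lemma \<open>path_sum_constant_on_condensed\<close>) and hence dominates the maximal requirement.

  The lower bounds on the capacities are now integral, and it remains to make the capacities
  integral without raising the cost. Plain rounding down can fail, since the cost may have negative coefficients in the
  cumulative capacities. Instead every capacity \<open>z\<close> is replaced by \<open>\<lfloor>z + u\<rfloor>\<close> with one common
  \<open>u\<close> in \<open>[0, 1)\<close>. This keeps capacities nondecreasing along paths, equal where they were equal,
  and at least every integer that they were at least. For uniformly distributed \<open>u\<close> the
  expectation of \<open>\<lfloor>z + u\<rfloor>\<close> is \<open>z\<close>, so the expected cost is unchanged and some \<open>u\<close> does not
  increase it (lemma \<open>exists_common_threshold\<close>).
\<close>

section \<open>Rounding with a common threshold\<close>

text \<open>
  On \<open>[0, 1)\<close> the function \<open>u \<mapsto> \<lfloor>z + u\<rfloor>\<close> is \<open>\<lfloor>z\<rfloor>\<close> plus the indicator of the final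
  interval of length \<open>frac z\<close>.
\<close>

lemma integral_floor_shift:
  fixes z :: real
  defines "M \<equiv> restrict_space lborel {0..<1::real}"
  shows "prob_space M"
    and "has_bochner_integral M (\<lambda>u. of_int \<lfloor>z + u\<rfloor>) z"
proof -
  show prob: "prob_space M"
    unfolding M_def by (rule prob_spaceI) (simp add: emeasure_restrict_space space_restrict_space)
  interpret prob_space M by (fact prob)
  have [measurable]: "{1 - frac z..<1} \<in> sets M"
    using frac_lt_1[of z] by (auto simp: M_def sets_restrict_space image_iff
        intro!: bexI[of _ "{1 - frac z..<1}"])
  have "emeasure M {1 - frac z..<1} = emeasure lborel {1 - frac z..<1}"
    unfolding M_def using frac_lt_1[of z] by (subst emeasure_restrict_space) auto
  then have m: "measure M {1 - frac z..<1} = frac z"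
    by (simp add: measure_def)
  have "has_bochner_integral M (indicator {1 - frac z..<1} :: real \<Rightarrow> real) (frac z)"
    using has_bochner_integral_real_indicator[of "{1 - frac z..<1}" M] m
    by (simp add: emeasure_eq_measure)
  moreover have "has_bochner_integral M (\<lambda>_. of_int \<lfloor>z\<rfloor> :: real) (of_int \<lfloor>z\<rfloor>)"
    by (simp add: has_bochner_integral_iff prob_space)
  ultimately have "has_bochner_integral M
      (\<lambda>u. of_int \<lfloor>z\<rfloor> + indicator {1 - frac z..<1} u) (of_int \<lfloor>z\<rfloor> + frac z)"
    by (rule has_bochner_integral_add[rotated])
  moreover have "of_int \<lfloor>z + u\<rfloor> = (of_int \<lfloor>z\<rfloor> + indicator {1 - frac z..<1} u :: real)"
    if "u \<in> space M" for u
  proof -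
    have "frac u = u" "\<lfloor>u\<rfloor> = 0"
      using that by (auto simp: M_def space_restrict_space frac_eq floor_eq_iff)
    then show ?thesis
      using that by (auto simp: floor_add indicator_def M_def space_restrict_space)
  qed
  ultimately show "has_bochner_integral M (\<lambda>u. of_int \<lfloor>z + u\<rfloor>) z"
    by (simp add: frac_def cong: has_bochner_integral_cong)
qed

text \<open>
  Some outcome is at most the expectation. The differences \<open>z - w\<close> are those of the cumulative
  capacities of a node and of its parent, whose roundings must share the same \<open>u\<close>.
\<close>

lemma exists_common_threshold:
  fixes c z w :: "'k \<Rightarrow> real"
  obtains u where "0 \<le> u" "u < 1"
    "(\<Sum>k\<in>K. c k * of_int (\<lfloor>z k + u\<rfloor> - \<lfloor>w k + u\<rfloor>)) \<le> (\<Sum>k\<in>K. c k * (z k - w k))"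
proof -
  define M where "M = restrict_space lborel {0..<1::real}"
  define F where "F u = (\<Sum>k\<in>K. c k * of_int (\<lfloor>z k + u\<rfloor> - \<lfloor>w k + u\<rfloor>))" for u
  define V where "V = (\<Sum>k\<in>K. c k * (z k - w k))"
  interpret prob_space M
    unfolding M_def by (rule integral_floor_shift)
  have "has_bochner_integral M F V"
    unfolding F_def V_def M_def of_int_diff
    by (intro has_bochner_integral_sum has_bochner_integral_mult_right
        has_bochner_integral_diff integral_floor_shift)
  then have F: "integrable M F" "expectation F = V"
    by (simp_all add: has_bochner_integral_iff)
  have "\<exists>u\<in>space M. F u \<le> V"
  proof (rule ccontr)
    assume "\<not> ?thesis"
    then have "AE u in M. V < F u"
      by (auto simp: not_le)
    then have "expectation (\<lambda>_. V) < expectation F"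
      using F by (intro integral_less_AE_space) (auto simp: emeasure_space_1)
    then show False
      using F by (simp add: prob_space)
  qed
  then show thesis
    using that by (auto simp: M_def F_def V_def space_restrict_space)
qed

section \<open>Scenario trees\<close>

context
  fixes S :: "('n, 'z) scenario_tree_scheme"
  assumes tree: "scenario_tree S"
begin

lemma finite_nodes: "finite (nodes S)"
  and root_in_nodes: "root_node S \<in> nodes S"
  and period_root: "period S (root_node S) = 1"
  and reachable: "n \<in> nodes S \<Longrightarrow> (root_node S, n) \<in> (edges S)\<^sup>*"
  and period_bounds: "n \<in> nodes S \<Longrightarrow> 1 \<le> period S n \<and> period S n \<le> horizon S"
  using tree unfolding scenario_tree_def rooted_tree_def by auto

lemma edgeD:
  assumes "(m, n) \<in> edges S"
  shows "m \<in> nodes S" "n \<in> nodes S" "period S n = Suc (period S m)" "n \<noteq> root_node S"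
  using assms tree unfolding scenario_tree_def rooted_tree_def by auto

lemma parent_unique:
  assumes "(m, n) \<in> edges S" "(m', n) \<in> edges S"
  shows "m' = m"
  using assms edgeD[OF assms(1)] tree
  unfolding scenario_tree_def rooted_tree_def by blast

lemma obtain_parent:
  assumes "n \<in> nodes S" "n \<noteq> root_node S"
  obtains m where "(m, n) \<in> edges S"
  using assms tree unfolding scenario_tree_def rooted_tree_def by blast

lemma rtrancl_period:
  assumes "(m, n) \<in> (edges S)\<^sup>*"
  shows "m = n \<or> period S m < period S n"
  using assms by induction (auto dest: edgeD)

lemma period_eq_1_iff:
  assumes "n \<in> nodes S"
  shows "period S n = 1 \<longleftrightarrow> n = root_node S"
  using rtrancl_period[OF reachable[OF assms]] period_root by auto

lemma prob_root: "prob S (root_node S) = 1"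
proof -
  have "stage S 1 = {root_node S}"
    using period_eq_1_iff root_in_nodes by (auto simp: stage_def)
  moreover have "(\<Sum>n\<in>stage S 1. prob S n) = 1"
    using tree period_bounds[OF root_in_nodes] unfolding scenario_tree_def by auto
  ultimately show ?thesis by simp
qed

lemma path_to_root: "path_to S (root_node S) = {root_node S}"
  using root_in_nodes period_root
  by (fastforce simp: path_to_def dest: rtrancl_period period_bounds)

lemma path_to_child:
  assumes "(m, n) \<in> edges S"
  shows "path_to S n = insert n (path_to S m)" "n \<notin> path_to S m"
proof -
  show "path_to S n = insert n (path_to S m)"
  proof (intro set_eqI iffI)
    fix k
    assume "k \<in> path_to S n"
    then have "k \<in> nodes S" "(k, n) \<in> (edges S)\<^sup>*"
      by (simp_all add: path_to_def)
    from this(2,1) show "k \<in> insert n (path_to S m)"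
      by cases (use parent_unique[OF assms] in \<open>auto simp: path_to_def\<close>)
  next
    fix k
    assume "k \<in> insert n (path_to S m)"
    then show "k \<in> path_to S n"
      using assms edgeD(2)[OF assms] by (auto simp: path_to_def intro: rtrancl_into_rtrancl)
  qed
  show "n \<notin> path_to S m"
    using rtrancl_period[of n m] edgeD[OF assms] by (auto simp: path_to_def)
qed

lemma finite_path_to: "finite (path_to S n)"
  using finite_nodes by (simp add: path_to_def)

lemma sum_path_child:
  fixes f :: "'n \<Rightarrow> 'b::comm_monoid_add"
  assumes "(m, n) \<in> edges S"
  shows "(\<Sum>k\<in>path_to S n. f k) = f n + (\<Sum>k\<in>path_to S m. f k)"
  using path_to_child[OF assms] finite_path_to by simp

text \<open>Recovers the cumulative capacities from the expansions defined as their increments.\<close>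

lemma sum_path_telescope:
  fixes f g :: "'n \<Rightarrow> 'b::ab_group_add"
  assumes "n \<in> nodes S"
    and "f (root_node S) = g (root_node S)"
    and "\<And>m n. (m, n) \<in> edges S \<Longrightarrow> f n = g n - g m"
  shows "(\<Sum>k\<in>path_to S n. f k) = g n"
  using reachable[OF assms(1)]
  by induction (simp_all add: path_to_root sum_path_child assms)

lemma ancestor_at_stage:
  assumes "n \<in> nodes S" "1 \<le> r" "r \<le> period S n"
  obtains j where "j \<in> stage S r" "n \<in> subtree S j"
proof -
  have "r \<le> period S n \<Longrightarrow> \<exists>j\<in>nodes S. period S j = r \<and> (j, n) \<in> (edges S)\<^sup>*"
    using reachable[OF assms(1)]
  proof induction
    case base
    then show ?case
      using assms(2) period_root root_in_nodes by auto
  next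
    case (step m n)
    note n = edgeD[OF step.hyps(2)]
    show ?case
    proof (cases "r = period S n")
      case False
      then show ?thesis
        using step n by (auto intro: rtrancl_into_rtrancl)
    qed (use n in auto)
  qed
  then show thesis
    using that assms by (auto simp: stage_def subtree_def)
qed

lemma parent_in_subtree:
  assumes "(m, n) \<in> edges S" "n \<in> subtree S j" "n \<noteq> j"
  shows "m \<in> subtree S j"
proof -
  have "(j, n) \<in> (edges S)\<^sup>*"
    using assms(2) by (simp add: subtree_def)
  then show ?thesis
    by cases (use assms(3) parent_unique[OF assms(1)] edgeD(1)[OF assms(1)] in
        \<open>auto simp: subtree_def\<close>)
qed

section \<open>The condensed tree\<close>

lemma condensed_nodes_cases:
  assumes "C \<in> condensed_nodes S r"
  obtains (before) t where "C = stage S t" "1 \<le> t" "t < r"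
  | (after) t j where "C = stage S t \<inter> subtree S j" "j \<in> stage S r" "r \<le> t"
  using assms unfolding condensed_nodes_def by blast

lemma condensed_nodes_subset:
  assumes "C \<in> condensed_nodes S r"
  shows "C \<subseteq> nodes S"
  using assms by (cases rule: condensed_nodes_cases) (auto simp: stage_def)

lemma finite_condensed_nodes: "finite (condensed_nodes S r)"
  by (rule finite_subset[of _ "Pow (nodes S)"])
    (use condensed_nodes_subset finite_nodes in auto)

lemma same_period:
  assumes "C \<in> condensed_nodes S r" "m \<in> C" "n \<in> C"
  shows "period S m = period S n"
  using assms(1) by (cases rule: condensed_nodes_cases) (use assms in \<open>auto simp: stage_def\<close>)

text \<open>
  A node of period at least \<open>r\<close> lies below an ancestor at stage \<open>r\<close>, since periods increase by
  one along edges.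
\<close>

lemma condensed_nodes_cover:
  assumes "n \<in> nodes S" "1 \<le> r"
  obtains C where "C \<in> condensed_nodes S r" "n \<in> C"
proof (cases "period S n < r")
  case True
  then show ?thesis
    using that[of "stage S (period S n)"] assms period_bounds[OF assms(1)]
    by (force simp: condensed_nodes_def stage_def)
next
  case False
  then obtain j where "j \<in> stage S r" "n \<in> subtree S j"
    using ancestor_at_stage[of n r] assms by auto
  then show ?thesis
    using that[of "stage S (period S n) \<inter> subtree S j"] assms False period_bounds[OF assms(1)]
    by (force simp: condensed_nodes_def stage_def)
qed

text \<open>
  This makes the condensed tree a quotient of the scenario tree. The one delicate place is stage
  \<open>r\<close>, where the description of the classes changes: each class there consists of a single node,
  whose parent is trivially merged with itself.
\<close>

lemma parents_merged:
  assumes C: "C \<in> condensed_nodes S r" "m \<in> C" "n \<in> C" and r: "1 \<le> r"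
    and E: "(m', m) \<in> edges S" "(n', n) \<in> edges S"
  obtains D where "D \<in> condensed_nodes S r" "m' \<in> D" "n' \<in> D"
proof (cases "m = n")
  case True
  then have "m' = n'"
    using E parent_unique by blast
  then show ?thesis
    using condensed_nodes_cover[of m' r] E(1) edgeD r that by metis
next
  case False
  note m = edgeD[OF E(1)] and n = edgeD[OF E(2)]
  note b = period_bounds[OF m(1)]
  from C(1) show ?thesis
  proof (cases rule: condensed_nodes_cases)
    case (before t)
    then have "m' \<in> stage S (t - 1)" "n' \<in> stage S (t - 1)" "1 \<le> t - 1" "t - 1 < r"
      using C m n b by (auto simp: stage_def)
    then show ?thesis
      using that[of "stage S (t - 1)"] by (auto simp: condensed_nodes_def)
  next
    case (after t j)
    then have s: "period S m = t" "period S n = t" "m \<in> subtree S j" "n \<in> subtree S j"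
        "period S j = r"
      using C by (auto simp: stage_def)
    have "t \<noteq> r"
      using False s rtrancl_period[of j m] rtrancl_period[of j n] by (auto simp: subtree_def)
    moreover from this have "m \<noteq> j" "n \<noteq> j"
      using s by auto
    ultimately have "m' \<in> stage S (t - 1) \<inter> subtree S j" "n' \<in> stage S (t - 1) \<inter> subtree S j"
      "r \<le> t - 1" "t - 1 \<le> horizon S"
      using s m n b after parent_in_subtree[OF E(1)] parent_in_subtree[OF E(2)]
      by (auto simp: stage_def)
    then show ?thesis
      using that[of "stage S (t - 1) \<inter> subtree S j"] after(2)
      unfolding condensed_nodes_def by blast
  qed
qed

text \<open>
  The classes left out of the condensed tree are empty, so equality on them is vacuous.
\<close>

lemma adaptive_iff_condensed:
  "adaptive S x t \<longleftrightarrow>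
     (\<forall>i. t i \<in> {1..horizon S} \<and>
       (\<forall>C\<in>condensed_nodes S (t i). \<forall>m\<in>C. \<forall>n\<in>C. x m $ i = x n $ i))"
proof (intro iffI allI conjI ballI)
  fix i C m n
  assume x: "adaptive S x t" and C: "C \<in> condensed_nodes S (t i)" "m \<in> C" "n \<in> C"
  from C(1) show "x m $ i = x n $ i"
    by (cases rule: condensed_nodes_cases) (use x C in \<open>unfold adaptive_def, blast\<close>)+
next
  assume x: "\<forall>i. t i \<in> {1..horizon S} \<and>
       (\<forall>C\<in>condensed_nodes S (t i). \<forall>m\<in>C. \<forall>n\<in>C. x m $ i = x n $ i)"
  show "adaptive S x t"
    unfolding adaptive_def
  proof (intro allI conjI ballI impI)
    fix i s m n
    assume *: "s < t i" "m \<in> stage S s" "n \<in> stage S s"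
    then have "stage S s \<in> condensed_nodes S (t i)"
      using period_bounds[of m] by (auto simp: condensed_nodes_def stage_def)
    then show "x m $ i = x n $ i"
      using x * by blast
  next
    fix i j s m n
    assume *: "j \<in> stage S (t i)" "t i \<le> s" "m \<in> stage S s \<inter> subtree S j"
      "n \<in> stage S s \<inter> subtree S j"
    then have "s \<le> horizon S"
      using period_bounds[of m] by (auto simp: stage_def)
    then have "stage S s \<inter> subtree S j \<in> condensed_nodes S (t i)"
      using * unfolding condensed_nodes_def by blast
    then show "x m $ i = x n $ i"
      using x[rule_format, THEN conjunct2, rule_format] *(3,4) by metis
  qed (use x in auto)
qed (auto simp: adaptive_def)

text \<open>
  Walk towards the root: merged nodes have merged parents, and the root is merged with no other
  node because it alone has period 1.
\<close>

lemma path_sum_constant_on_condensed: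
  fixes f :: "'n \<Rightarrow> 'b::comm_monoid_add"
  assumes r: "1 \<le> r"
    and f: "\<And>C m n. C \<in> condensed_nodes S r \<Longrightarrow> m \<in> C \<Longrightarrow> n \<in> C \<Longrightarrow> f m = f n"
    and C: "C \<in> condensed_nodes S r" "m \<in> C" "n \<in> C"
  shows "(\<Sum>k\<in>path_to S m. f k) = (\<Sum>k\<in>path_to S n. f k)"
proof -
  have "m \<in> nodes S"
    using C condensed_nodes_subset by blast
  from reachable[OF this] C show ?thesis
  proof (induction arbitrary: C n)
    case base
    then have "n = root_node S"
      using same_period condensed_nodes_subset period_root period_eq_1_iff by (metis subsetD)
    then show ?case by simp
  next
    case (step m' m)
    have "n \<in> nodes S"
      using step.prems condensed_nodes_subset by blast
    moreover have "n \<noteq> root_node S"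
      using same_period[OF step.prems] edgeD[OF step.hyps(2)] period_eq_1_iff period_root by metis
    ultimately obtain n' where n': "(n', n) \<in> edges S"
      using obtain_parent by blast
    obtain D where D: "D \<in> condensed_nodes S r" "m' \<in> D" "n' \<in> D"
      using parents_merged[OF step.prems r step.hyps(2) n'] .
    show ?case
      using sum_path_child[OF step.hyps(2), of f] sum_path_child[OF n', of f]
        step.IH[OF D] f[OF step.prems] by simp
  qed
qed

end

section \<open>Rounding a relaxed solution\<close>

definition rounding_gap ::
    "('n, 'i::finite, 'j::finite, 'k::finite) capacity_problem \<Rightarrow>
     ('n \<Rightarrow> real ^ 'j) \<Rightarrow> 'i \<Rightarrow> nat \<Rightarrow> real" where
  "rounding_gap P y i r =
     Max ((\<lambda>C. of_int \<lceil>condensed_capacity P y i C\<rceil> - condensed_capacity P y i C)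
       ` condensed_nodes P r)"

lemma rounding_gap_ge:
  assumes "scenario_tree P" "C \<in> condensed_nodes P r"
  shows "of_int \<lceil>condensed_capacity P y i C\<rceil> - condensed_capacity P y i C \<le> rounding_gap P y i r"
  unfolding rounding_gap_def using assms finite_condensed_nodes by (intro Max_ge) auto

lemma rounding_gap_nonneg:
  assumes P: "scenario_tree P" and r: "1 \<le> r"
  shows "0 \<le> rounding_gap P y i r"
proof -
  obtain C where "C \<in> condensed_nodes P r"
    using condensed_nodes_cover[OF P root_in_nodes[OF P] r] .
  then show ?thesis
    using rounding_gap_ge[OF P, of C r y i] le_of_int_ceiling[of "condensed_capacity P y i C"]
    by linarith
qed

text \<open>
  Lifting by the gap reaches the integer \<open>\<lceil>\<delta>\<rceil>\<close>, and rounding down cannot fall below an integer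
  already reached.
\<close>

lemma shifted_capacity_suffices:
  fixes P :: "('n, 'i::finite, 'j::finite, 'k::finite) capacity_problem"
  assumes P: "scenario_tree P"
    and C: "C \<in> condensed_nodes P r" "n \<in> C"
    and enough: "\<And>m. m \<in> C \<Longrightarrow> required_capacity P y i m \<le> X"
    and u: "0 \<le> u"
  shows "required_capacity P y i n \<le> of_int \<lfloor>X + rounding_gap P y i r + u\<rfloor>"
proof -
  have fin: "finite C"
    using condensed_nodes_subset[OF P C(1)] finite_nodes[OF P] by (rule finite_subset)
  have "condensed_capacity P y i C \<le> X"
    unfolding condensed_capacity_def using fin C(2) enough by (subst Max_le_iff) auto
  then have "of_int \<lceil>condensed_capacity P y i C\<rceil> \<le> X + rounding_gap P y i r + u"
    using rounding_gap_ge[OF P C(1), of y i] u by linarith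
  then have "\<lceil>condensed_capacity P y i C\<rceil> \<le> \<lfloor>X + rounding_gap P y i r + u\<rfloor>"
    by (simp add: le_floor_iff)
  moreover have "required_capacity P y i n \<le> condensed_capacity P y i C"
    unfolding condensed_capacity_def using fin C(2) by (intro Max_ge) auto
  ultimately show ?thesis
    by (meson ceiling_le_iff order_trans)
qed

text \<open>
  Lift the cumulative capacities by the gap, round them with a common threshold, and take
  increments along the edges as the new expansion decisions.
\<close>

lemma relaxed_solution_rounding:
  fixes P :: "('n, 'i::finite, 'j::finite, 'k::finite) capacity_problem"
  assumes P: "scenario_tree P" and feas: "relaxed_feasible P x y t"
  obtains x' where "ats_feasible P x' y t"
    "objective P x' y \<le> objective P x y +
       (\<Sum>i\<in>UNIV. rounding_gap P y i (t i) * expansion_cost P (root_node P) $ i)"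
proof -
  \<comment> \<open>\<open>Z n\<close> is the lifted cumulative capacity and \<open>W n\<close> its value at the parent of \<open>n\<close>, written
    without the parent so that equality on condensed nodes is immediate. The value 0 at the root
    makes the lift a purchase at the root.\<close>
  define X where "X n i = (\<Sum>m\<in>path_to P n. x m $ i)" for n i
  define Z where "Z n i = X n i + rounding_gap P y i (t i)" for n i
  define W where "W n i = (if n = root_node P then 0 else Z n i - x n $ i)" for n i
  define c where "c n i = prob P n * expansion_cost P n $ i" for n i

  have t: "1 \<le> t i" for i
    using feas by (simp add: relaxed_feasible_def adaptive_def)
  have x_nonneg: "0 \<le> x n $ i" if "n \<in> nodes P" for n i
    using feas that by (simp add: relaxed_feasible_def less_eq_vec_def)
  have x_const: "x m $ i = x n $ i"
    if "C \<in> condensed_nodes P (t i)" "m \<in> C" "n \<in> C" for C m n i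
    using feas that unfolding relaxed_feasible_def adaptive_iff_condensed[OF P] by blast
  have X_const: "X m i = X n i"
    if "C \<in> condensed_nodes P (t i)" "m \<in> C" "n \<in> C" for C m n i
    unfolding X_def
    by (rule path_sum_constant_on_condensed[OF P t _ that]) (rule x_const)
  have X_enough: "required_capacity P y i n \<le> X n i" if "n \<in> nodes P" for n i
    using feas that
    by (auto simp: relaxed_feasible_def less_eq_vec_def required_capacity_def X_def)
  have Z_root: "Z (root_node P) i = x (root_node P) $ i + rounding_gap P y i (t i)" for i
    by (simp add: Z_def X_def path_to_root[OF P])
  have W_child: "W n i = Z m i" if "(m, n) \<in> edges P" for m n i
    using sum_path_child[OF P that, of "\<lambda>k. x k $ i"] edgeD(4)[OF P that]
    by (simp add: W_def Z_def X_def)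
  have W_le_Z: "W n i \<le> Z n i" if "n \<in> nodes P" for n i
    using x_nonneg[OF that, of i] rounding_gap_nonneg[OF P t, of y i i]
    by (auto simp: W_def Z_root)

  obtain u where u: "0 \<le> u" "u < 1"
    and cost: "(\<Sum>(n, i)\<in>nodes P \<times> UNIV. c n i * of_int (\<lfloor>Z n i + u\<rfloor> - \<lfloor>W n i + u\<rfloor>))
      \<le> (\<Sum>(n, i)\<in>nodes P \<times> UNIV. c n i * (Z n i - W n i))"
    using exists_common_threshold[where c = "case_prod c" and z = "case_prod Z" and
        w = "case_prod W" and K = "nodes P \<times> UNIV"]
    by (auto simp: case_prod_unfold)
  define x' where "x' n = (\<chi> i. of_int (\<lfloor>Z n i + u\<rfloor> - \<lfloor>W n i + u\<rfloor>) :: real ^ 'i)" for n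

  have path: "(\<Sum>m\<in>path_to P n. x' m $ i) = of_int \<lfloor>Z n i + u\<rfloor>" if "n \<in> nodes P" for n i
  proof (rule sum_path_telescope[OF P that])
    \<comment> \<open>Here \<open>u < 1\<close> matters: the value 0 before the root must round to 0.\<close>
    have "\<lfloor>u\<rfloor> = 0"
      using u by linarith
    then show "x' (root_node P) $ i = of_int \<lfloor>Z (root_node P) i + u\<rfloor>"
      by (simp add: x'_def W_def)
  qed (simp add: x'_def W_child)

  have "adaptive P x' t"
    unfolding adaptive_iff_condensed[OF P]
  proof (intro allI conjI ballI)
    fix i C m n
    assume C: "C \<in> condensed_nodes P (t i)" "m \<in> C" "n \<in> C"
    have "m = root_node P \<longleftrightarrow> n = root_node P"
      using period_eq_1_iff[OF P] same_period[OF P C] condensed_nodes_subset[OF P C(1)] C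
      by (metis subsetD)
    then show "x' m $ i = x' n $ i"
      using X_const[OF C] x_const[OF C] by (simp add: x'_def W_def Z_def)
  qed (use feas in \<open>auto simp: relaxed_feasible_def adaptive_def\<close>)
  moreover have "usage P n *v y n \<le> (\<Sum>m\<in>path_to P n. x' m)" if n: "n \<in> nodes P" for n
    unfolding less_eq_vec_def
  proof
    fix i
    obtain C where C: "C \<in> condensed_nodes P (t i)" "n \<in> C"
      using condensed_nodes_cover[OF P n t] .
    have "required_capacity P y i m \<le> X n i" if "m \<in> C" for m
      using X_enough[of m i] X_const[OF C(1) that C(2)] condensed_nodes_subset[OF P C(1)] that
      by auto
    then have "required_capacity P y i n \<le> of_int \<lfloor>Z n i + u\<rfloor>"
      unfolding Z_def by (rule shifted_capacity_suffices[OF P C _ u(1)])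
    then show "(usage P n *v y n) $ i \<le> (\<Sum>m\<in>path_to P n. x' m) $ i"
      by (simp add: required_capacity_def path[OF n])
  qed
  moreover have "0 \<le> x' n" if "n \<in> nodes P" for n
    using W_le_Z[OF that] by (auto simp: x'_def less_eq_vec_def intro!: floor_mono)
  moreover have "x' n $ i \<in> \<int>" for n i
    by (simp add: x'_def)
  ultimately have feas': "ats_feasible P x' y t"
    using feas unfolding ats_feasible_def relaxed_feasible_def by blast

  have split: "objective P v y =
      (\<Sum>n\<in>nodes P. \<Sum>i\<in>UNIV. c n i * v n $ i) + (\<Sum>n\<in>nodes P. prob P n * (allocation_cost P n \<bullet> y n))"
    for v :: "'n \<Rightarrow> real ^ 'i"
    by (simp add: objective_def inner_vec_def c_def sum.distrib distrib_left sum_distrib_left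
        mult.assoc)
  have "(\<Sum>n\<in>nodes P. \<Sum>i\<in>UNIV. c n i * x' n $ i)
      \<le> (\<Sum>n\<in>nodes P. \<Sum>i\<in>UNIV. c n i * (Z n i - W n i))"
    using cost by (simp add: x'_def sum.cartesian_product)
  \<comment> \<open>The increments \<open>Z n - W n\<close> are the relaxed expansions except at the root, where they exceed
    them by the gap; this is the only extra cost.\<close>
  also have "\<dots> = (\<Sum>n\<in>nodes P. (\<Sum>i\<in>UNIV. c n i * x n $ i) +
      (if n = root_node P then \<Sum>i\<in>UNIV. c n i * rounding_gap P y i (t i) else 0))"
    by (intro sum.cong)
      (auto simp: W_def Z_root sum.distrib[symmetric] distrib_left)
  also have "\<dots> = (\<Sum>n\<in>nodes P. \<Sum>i\<in>UNIV. c n i * x n $ i) +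
      (\<Sum>i\<in>UNIV. rounding_gap P y i (t i) * expansion_cost P (root_node P) $ i)"
    using finite_nodes[OF P] root_in_nodes[OF P] prob_root[OF P]
    by (simp add: sum.distrib c_def mult.commute)
  finally have "objective P x' y \<le> objective P x y +
       (\<Sum>i\<in>UNIV. rounding_gap P y i (t i) * expansion_cost P (root_node P) $ i)"
    unfolding split by linarith
  with feas' show thesis by (rule that)
qed

section \<open>The bound for the algorithm\<close>

theorem proposition8:
  fixes P :: "('n, 'i::finite, 'j::finite, 'k::finite) capacity_problem"
    and x_LP x_R :: "'n \<Rightarrow> real ^ 'i"
    and y_LP y_R :: "'n \<Rightarrow> real ^ 'j"
    and t_R :: "'i \<Rightarrow> nat"
  assumes "capacity_expansion P"
    and "ats_relax_step1 P x_LP y_LP t_R"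
    and "ats_relax_step3 P t_R x_R y_R"
  shows "objective P x_R y_R - ats_value P \<le>
    (\<Sum>i\<in>UNIV.
       Max ((\<lambda>C. of_int \<lceil>condensed_capacity P y_LP i C\<rceil> - condensed_capacity P y_LP i C)
              ` condensed_nodes P (t_R i))
       * expansion_cost P (root_node P) $ i)"
proof -
  have LP: "relaxed_feasible P x_LP y_LP t_R"
    "\<And>x y t. relaxed_feasible P x y t \<Longrightarrow> objective P x_LP y_LP \<le> objective P x y"
    using assms(2) by (auto simp: ats_relax_step1_def is_arg_min_linorder)
  have R: "ats_feasible P x_R y_R t_R"
    "\<And>x y. ats_feasible P x y t_R \<Longrightarrow> objective P x_R y_R \<le> objective P x y"
    using assms(3) by (auto simp: ats_relax_step3_def is_arg_min_linorder)
  \<comment> \<open>The solution of Step 3 shows that the infimum is over a nonempty set.\<close>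
  have "objective P x_LP y_LP \<le> ats_value P"
    unfolding ats_value_def
    by (rule cInf_greatest) (use R(1) LP(2) in \<open>auto simp: ats_feasible_def\<close>)
  moreover obtain x' where "ats_feasible P x' y_LP t_R"
    "objective P x' y_LP \<le> objective P x_LP y_LP +
       (\<Sum>i\<in>UNIV. rounding_gap P y_LP i (t_R i) * expansion_cost P (root_node P) $ i)"
    using relaxed_solution_rounding[OF _ LP(1)] assms(1) unfolding capacity_expansion_def by blast
  ultimately show ?thesis
    using R(2)[of x' y_LP] unfolding rounding_gap_def by linarith
qed

end
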